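(* Let $g=1+\sum_{|\alpha|\ge1}b_\alpha Z_\alpha$ be a free holomorphic function in a neighborhood of the origin with $b_\alpha>0$ and $\sup_{\alpha\in\mathbb F_n^+}\frac{b_\alpha}{b_{g_i\alpha}}<\infty$ for every $i\in\{1,\ldots,n\}$. Assume that the universal model ${\bf W}=(W_1,\ldots,W_n)$ associated with $g$ has the boundary property. Then $(F^2(H_n),{\bf W})$ is rigid.
   Context: Fix an integer $n\ge 1$ and an $n$-dimensional complex Hilbert space $H_n$ with orthonormal basis $e_1,\ldots,e_n$. The full Fock space is $F^2(H_n)=\bigoplus_{k\ge0}H_n^{\otimes k}$, $H_n^{\otimes 0}=\mathbb C1$; left creation operators: $S_i\varphi=e_i\otimes\varphi$. $\mathbb F_n^+$ is the unital free semigroup on generators $g_1,\ldots,g_n$ with identity $g_0$; $|\alpha|$ is the length of $\alpha$. For $\alpha=g_{i_1}\cdots g_{i_k}$ put $e_\alpha=e_{i_1}\otimes\cdots\otimes e_{i_k}$, $e_{g_0}=1$, $Z_\alpha=Z_{i_1}\cdots Z_{i_k}$. A formal power series $g=1+\sum_{|\alpha|\ge1}b_\alpha Z_\alpha$ (with $b_{g_0}=1$, $b_\alpha>0$) in noncommuting indeterminates is free holomorphic in a neighborhood of the origin if $\limsup_{k}(\sum_{|\alpha|=k}b_\alpha^2)^{1/2k}<\infty$. The universal model ${\bf W}$ associated with $g$ consists of the weighted left creation operators $W_i=S_iD_i$ on $F^2(H_n)$, where $D_ie_\alpha=\sqrt{b_\alpha/b_{g_i\alpha}}\,e_\alpha$.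 $C^*({\bf W})$ is the $C^*$-algebra generated by $W_1,\ldots,W_n$ and the identity (it is irreducible). Given a unital $C^*$-algebra $\mathcal B$ and a linear subspace $\mathcal S\subset\mathcal B$ containing the identity with $\mathcal B=C^*(\mathcal S)$, an irreducible representation $\pi:\mathcal B\to B(\mathcal H)$ is a boundary representation for $\mathcal S$ if $\pi|_{\mathcal S}$ has a unique completely positive extension to $\mathcal B$, namely $\pi$ itself. ${\bf W}$ has the boundary property if the identity representation of $C^*({\bf W})$ is a boundary representation for $\mathrm{span}\{I,W_1,\ldots,W_n\}$. Closed subspaces $\mathcal M,\mathcal N\subset F^2(H_n)$ invariant under $W_1,\ldots,W_n$ are (unitarily) equivalent if there is a unitary $U:\mathcal M\to\mathcal N$ with $U(W_i|_{\mathcal M})=(W_i|_{\mathcal N})U$ for all $i$. $(\mathcal M,{\bf W})$ is rigid if every closed invariant subspace $\mathcal N\subset F^2(H_n)$ under $W_1,\ldots,W_n$ that is unitarily equivalent to $\mathcal M$ equals $\mathcal M$. *)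

theory Defs
  imports "HOL-Analysis.Analysis"
begin

section \<open>Complex Hilbert spaces\<close>

class scaleC =
  fixes scaleC :: "complex \<Rightarrow> 'a \<Rightarrow> 'a"  (infixr \<open>*\<^sub>C\<close> 75)

class complex_vector = real_vector + scaleC +
  assumes scaleC_add_right: "c *\<^sub>C (x + y) = c *\<^sub>C x + c *\<^sub>C y"
    and scaleC_add_left: "(c + d) *\<^sub>C x = c *\<^sub>C x + d *\<^sub>C x"
    and scaleC_scaleC: "c *\<^sub>C d *\<^sub>C x = (c * d) *\<^sub>C x"
    and scaleR_eq_scaleC: "r *\<^sub>R x = complex_of_real r *\<^sub>C x"

class complex_normed_vector = complex_vector + real_normed_vector +
  assumes norm_scaleC: "norm (c *\<^sub>C x) = cmod c * norm x"

text \<open>\<open>cinner\<close> is linear in its first argument; the norm and the real inner product of the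
  underlying real Hilbert space are determined by \<open>cinner\<close>.\<close>

class complex_hilbert_space = complex_normed_vector + real_inner + banach +
  fixes cinner :: "'a \<Rightarrow> 'a \<Rightarrow> complex"
  assumes cinner_commute: "cinner x y = cnj (cinner y x)"
    and cinner_add_left: "cinner (x + y) z = cinner x z + cinner y z"
    and cinner_scaleC_left: "cinner (c *\<^sub>C x) y = c * cinner x y"
    and inner_eq_Re_cinner: "inner x y = Re (cinner x y)"

lemma scaleC_one: "1 *\<^sub>C x = (x :: 'a::complex_vector)"
  using scaleR_eq_scaleC[of 1 x] by simp

global_interpretation complex_vector:
  vector_space "scaleC :: complex \<Rightarrow> 'a \<Rightarrow> 'a::complex_vector"
  defines csubspace = complex_vector.subspace
    and cspan = complex_vector.span
  by unfold_locales (simp_all add: scaleC_add_right scaleC_add_left scaleC_scaleC scaleC_one)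

definition clinear_on :: "'a::complex_vector set \<Rightarrow> ('a \<Rightarrow> 'b::complex_vector) \<Rightarrow> bool" where
  "clinear_on V f \<longleftrightarrow>
     (\<forall>x\<in>V. \<forall>y\<in>V. f (x + y) = f x + f y) \<and> (\<forall>c. \<forall>x\<in>V. f (c *\<^sub>C x) = c *\<^sub>C f x)"

text \<open>The type \<open>'a \<Rightarrow>\<^sub>L 'b\<close> consists of the bounded real-linear maps. It is a complex vector
  space under \<open>(c *\<^sub>C T) x = c *\<^sub>C T x\<close>; its complex-linear elements form the set \<open>B(H, K)\<close>.\<close>

instantiation blinfun :: (real_normed_vector, complex_normed_vector) complex_normed_vector
begin

lift_definition scaleC_blinfun :: "complex \<Rightarrow> 'a \<Rightarrow>\<^sub>L 'b \<Rightarrow> 'a \<Rightarrow>\<^sub>L 'b" is "\<lambda>c T x. c *\<^sub>C T x"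
proof -
  fix c :: complex and T :: "'a \<Rightarrow> 'b"
  assume T: "bounded_linear T"
  then obtain K where K: "\<And>x. norm (T x) \<le> norm x * K"
    using bounded_linear.bounded by blast
  interpret T: bounded_linear T by (rule T)
  show "bounded_linear (\<lambda>x. c *\<^sub>C T x)"
  proof (rule bounded_linear_intro[where K = "cmod c * K"])
    show "norm (c *\<^sub>C T x) \<le> norm x * (cmod c * K)" for x
      using mult_left_mono[OF K norm_ge_zero[of c]] by (simp add: norm_scaleC mult_ac)
  qed (simp_all add: T.add T.scaleR scaleC_add_right scaleR_eq_scaleC scaleC_scaleC mult.commute)
qed

instance
proof
  fix c d :: complex and r :: real and S T :: "'a \<Rightarrow>\<^sub>L 'b"
  show "c *\<^sub>C (S + T) = c *\<^sub>C S + c *\<^sub>C T"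
    by transfer (simp add: scaleC_add_right)
  show "(c + d) *\<^sub>C T = c *\<^sub>C T + d *\<^sub>C T"
    by transfer (simp add: scaleC_add_left)
  show "c *\<^sub>C d *\<^sub>C T = (c * d) *\<^sub>C T"
    by transfer (simp add: scaleC_scaleC)
  show "r *\<^sub>R T = complex_of_real r *\<^sub>C T"
    by transfer (simp add: scaleR_eq_scaleC)
  have le: "norm (c *\<^sub>C T) \<le> cmod c * norm T" for c and T :: "'a \<Rightarrow>\<^sub>L 'b"
  proof (rule norm_blinfun_bound)
    fix x
    have "blinfun_apply (c *\<^sub>C T) x = c *\<^sub>C blinfun_apply T x" by transfer simp
    then show "norm (blinfun_apply (c *\<^sub>C T) x) \<le> cmod c * norm T * norm x"
      using mult_left_mono[OF norm_blinfun[of T x] norm_ge_zero[of c]]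
      by (simp add: norm_scaleC mult_ac)
  qed simp
  show "norm (c *\<^sub>C T) = cmod c * norm T"
  proof (cases "c = 0")
    case True
    then show ?thesis using le[of 0 T] by simp
  next
    case False
    have "inverse c *\<^sub>C c *\<^sub>C T = T"
      using False by transfer (simp add: scaleC_scaleC scaleC_one)
    with le[of "inverse c" "c *\<^sub>C T"] have "norm T \<le> inverse (cmod c) * norm (c *\<^sub>C T)"
      by (simp add: norm_inverse)
    with False have "cmod c * norm T \<le> norm (c *\<^sub>C T)"
      by (simp add: field_simps)
    with le[of c T] show ?thesis by simp
  qed
qed

end

lemma scaleC_blinfun_apply [simp]: "blinfun_apply (c *\<^sub>C T) x = c *\<^sub>C blinfun_apply T x"
  by transfer simp

definition bounded_ops :: "('a::complex_normed_vector \<Rightarrow>\<^sub>L 'b::complex_normed_vector) set" where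
  "bounded_ops = {T. clinear_on UNIV (blinfun_apply T)}"

text \<open>Every bounded complex-linear operator on a Hilbert space has exactly one adjoint, see
  \<open>cinner_adjoint\<close> and \<open>adjoint_op_unique\<close> below. On maps that are not complex linear
  \<open>adjoint_op\<close> is unspecified.\<close>

definition adjoint_op ::
    "('a::complex_hilbert_space \<Rightarrow>\<^sub>L 'b::complex_hilbert_space) \<Rightarrow> 'b \<Rightarrow>\<^sub>L 'a" where
  "adjoint_op T = (THE T'. \<forall>x y. cinner (blinfun_apply T x) y = cinner x (blinfun_apply T' y))"

lemma riesz_real:
  fixes f :: "'a::{real_inner, complete_space} \<Rightarrow> real"
  assumes f: "bounded_linear f"
  shows "\<exists>y. \<forall>x. f x = inner x y"
proof (cases "\<forall>x. f x = 0")
  case True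
  then show ?thesis by (intro exI[of _ 0]) simp
next
  case False
  then obtain v where v: "f v \<noteq> 0" by blast
  interpret f: bounded_linear f by (rule f)
  define C where "C = {x. f x = 1}"
  have "(1 / f v) *\<^sub>R v \<in> C" using v by (simp add: C_def f.scaleR)
  then have C: "C \<noteq> {}" by blast
  define d where "d = Inf (norm ` C)"
  have bdd: "bdd_below (norm ` C)" by (rule bdd_belowI[of _ 0]) auto
  have d: "d \<le> norm x" if "x \<in> C" for x
    unfolding d_def using that bdd by (intro cInf_lower) auto
  have d0: "d \<ge> 0" unfolding d_def using C by (intro cInf_greatest) auto
  have "\<exists>x\<in>C. norm x < d + 1 / real (Suc n)" for n
    using cInf_lessD[of "norm ` C" "d + 1 / real (Suc n)"] C unfolding d_def by auto
  then obtain X where X: "\<And>n. X n \<in> C" "\<And>n. norm (X n) < d + 1 / real (Suc n)"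
    by metis
  have par: "(norm (x - y))\<^sup>2 \<le> 2 * (norm x)\<^sup>2 + 2 * (norm y)\<^sup>2 - 4 * d\<^sup>2"
    if "x \<in> C" "y \<in> C" for x y
  proof -
    have "(1/2) *\<^sub>R (x + y) \<in> C" using that by (simp add: C_def f.scaleR f.add)
    then have "d \<le> norm (x + y) / 2" using d[of "(1/2) *\<^sub>R (x + y)"] by simp
    then have "d\<^sup>2 \<le> (norm (x + y) / 2)\<^sup>2" using d0 by (rule power_mono)
    then have "4 * d\<^sup>2 \<le> (norm (x + y))\<^sup>2" by (simp add: power_divide)
    moreover have "(norm (x - y))\<^sup>2 + (norm (x + y))\<^sup>2 = 2 * (norm x)\<^sup>2 + 2 * (norm y)\<^sup>2"
      by (simp add: power2_norm_eq_inner algebra_simps inner_commute)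
    ultimately show ?thesis by linarith
  qed
  have sq: "(norm (X n))\<^sup>2 - d\<^sup>2 \<le> (2 * d + 1) / real (Suc n)" for n
  proof -
    define e where "e = 1 / real (Suc n)"
    have e: "0 < e" "e \<le> 1" by (simp_all add: e_def)
    have "(norm (X n))\<^sup>2 \<le> (d + e)\<^sup>2"
      using X(2)[of n] by (intro power_mono) (auto simp: e_def)
    also have "\<dots> = d\<^sup>2 + 2 * d * e + e * e" by (simp add: power2_eq_square algebra_simps)
    also have "\<dots> \<le> d\<^sup>2 + 2 * d * e + e"
      using e mult_left_le[of e e] by simp
    finally have "(norm (X n))\<^sup>2 - d\<^sup>2 \<le> (2 * d + 1) * e" by (simp add: algebra_simps)
    then show ?thesis by (simp add: e_def)
  qed
  have "Cauchy X"
  proof (rule metric_CauchyI)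
    fix e :: real assume e: "e > 0"
    obtain N where N: "4 * (2 * d + 1) / e\<^sup>2 < real N" using reals_Archimedean2 by blast
    have "dist (X m) (X n) < e" if "m \<ge> N" "n \<ge> N" for m n
    proof -
      have small: "(norm (X k))\<^sup>2 - d\<^sup>2 < e\<^sup>2 / 4" if "k \<ge> N" for k
      proof -
        have "4 * (2 * d + 1) / e\<^sup>2 < real (Suc k)" using N that by linarith
        then have "(2 * d + 1) / real (Suc k) < e\<^sup>2 / 4" using e by (simp add: field_simps)
        with sq[of k] show ?thesis by (rule le_less_trans)
      qed
      have "(norm (X m - X n))\<^sup>2 \<le> 2 * ((norm (X m))\<^sup>2 - d\<^sup>2) + 2 * ((norm (X n))\<^sup>2 - d\<^sup>2)"
        using par[OF X(1) X(1), of m n] by simp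
      also have "\<dots> < e\<^sup>2"
      proof -
        have "2 * p + 2 * q < r" if "p < r / 4" "q < r / 4" for p q r :: real
          using that by linarith
        then show ?thesis using small[OF that(1)] small[OF that(2)] by blast
      qed
      finally show ?thesis using e by (simp add: dist_norm power_less_imp_less_base)
    qed
    then show "\<exists>N. \<forall>m\<ge>N. \<forall>n\<ge>N. dist (X m) (X n) < e" by blast
  qed
  then obtain x where x: "X \<longlonglongrightarrow> x" using Cauchy_convergent convergent_def by blast
  have "(\<lambda>n. f (X n)) \<longlonglongrightarrow> f x" by (rule f.tendsto[OF x])
  with X(1) have fx: "f x = 1" by (simp add: C_def LIMSEQ_const_iff)
  have "(\<lambda>n. d + 1 / real (Suc n)) \<longlonglongrightarrow> d + 0"
    by (intro tendsto_intros LIMSEQ_Suc[OF lim_1_over_n])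
  moreover have "(\<lambda>n. norm (X n)) \<longlonglongrightarrow> norm x" by (intro tendsto_norm x)
  ultimately have nx: "norm x \<le> d"
    using X(2) by (intro LIMSEQ_le[where X = "\<lambda>n. norm (X n)"]) (auto intro: less_imp_le)
  have orth: "inner x k = 0" if k: "f k = 0" for k
  proof (cases "k = 0")
    case False
    define t where "t = - inner x k / inner k k"
    have kk: "inner k k > 0" using False by simp
    have "x + t *\<^sub>R k \<in> C" using fx k by (simp add: C_def f.add f.scaleR)
    then have "norm x \<le> norm (x + t *\<^sub>R k)" using d nx by force
    then have "(norm x)\<^sup>2 \<le> (norm (x + t *\<^sub>R k))\<^sup>2" by (rule power_mono) simp
    then have "0 \<le> 2 * t * inner x k + t * t * inner k k"
      by (simp add: power2_norm_eq_inner algebra_simps inner_commute)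
    also have "\<dots> = - (inner x k)\<^sup>2 / inner k k"
      using kk by (simp add: t_def field_simps power2_eq_square)
    finally show ?thesis using kk by (simp add: field_simps)
  qed simp
  have xx: "inner x x \<noteq> 0" using fx f.zero by force
  show ?thesis
  proof (intro exI allI)
    fix u
    have "inner x (u - f u *\<^sub>R x) = 0" by (rule orth) (simp add: f.diff f.scaleR fx)
    then show "f u = inner u ((1 / inner x x) *\<^sub>R x)"
      using xx by (simp add: inner_diff_right inner_commute field_simps)
  qed
qed

lemma Im_cinner: "Im (cinner x y) = - inner (\<i> *\<^sub>C x) y"
  by (simp add: inner_eq_Re_cinner cinner_scaleC_left)

lemma adjoint_op_unique:
  fixes T :: "'a::complex_hilbert_space \<Rightarrow>\<^sub>L 'b::complex_hilbert_space"
  assumes "\<forall>x y. cinner (blinfun_apply T x) y = cinner x (blinfun_apply T' y)"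
  shows "adjoint_op T = T'"
  unfolding adjoint_op_def
proof (rule the_equality)
  fix R assume R: "\<forall>x y. cinner (blinfun_apply T x) y = cinner x (blinfun_apply R y)"
  show "R = T'"
  proof (rule blinfun_eqI)
    fix y
    have "inner x (blinfun_apply R y) = inner x (blinfun_apply T' y)" for x
      using R assms by (simp add: inner_eq_Re_cinner)
    then show "blinfun_apply R y = blinfun_apply T' y" using vector_eq_ldot by blast
  qed
qed (use assms in blast)

lemma cinner_adjoint:
  fixes T :: "'a::complex_hilbert_space \<Rightarrow>\<^sub>L 'b::complex_hilbert_space"
  assumes T: "T \<in> bounded_ops"
  shows "cinner (blinfun_apply T x) y = cinner x (blinfun_apply (adjoint_op T) y)"
proof -
  have "\<exists>z. \<forall>x. inner (blinfun_apply T x) y = inner x z" for y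
    by (intro riesz_real bounded_linear_intros)
  then obtain A where A: "\<And>x y. inner (blinfun_apply T x) y = inner x (A y)" by metis
  have "bounded_linear A"
  proof (rule bounded_linear_intro[where K = "norm T"])
    show "A (y + z) = A y + A z" for y z
      by (subst vector_eq_ldot[symmetric]) (simp add: A[symmetric] inner_add_right)
    show "A (r *\<^sub>R y) = r *\<^sub>R A y" for r y
      by (subst vector_eq_ldot[symmetric]) (simp add: A[symmetric])
    show "norm (A y) \<le> norm y * norm T" for y
    proof (cases "A y = 0")
      case False
      have "norm (A y) * norm (A y) = inner (blinfun_apply T (A y)) y"
        by (simp add: A norm_eq_sqrt_inner)
      also have "\<dots> \<le> norm T * norm (A y) * norm y"
        using norm_cauchy_schwarz[of "blinfun_apply T (A y)" y] norm_blinfun[of T "A y"]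
        by (meson mult_right_mono norm_ge_zero order_trans)
      finally show ?thesis using False by (simp add: mult_ac)
    qed simp
  qed
  then have A': "blinfun_apply (Blinfun A) = A" by (rule bounded_linear_Blinfun_apply)
  have lin: "\<i> *\<^sub>C blinfun_apply T x = blinfun_apply T (\<i> *\<^sub>C x)" for x
    using T by (simp add: bounded_ops_def clinear_on_def)
  have *: "cinner (blinfun_apply T x) y = cinner x (blinfun_apply (Blinfun A) y)" for x y
  proof (rule complex_eqI)
    show "Re (cinner (blinfun_apply T x) y) = Re (cinner x (blinfun_apply (Blinfun A) y))"
      unfolding inner_eq_Re_cinner[symmetric] A' by (rule A)
    show "Im (cinner (blinfun_apply T x) y) = Im (cinner x (blinfun_apply (Blinfun A) y))"
      unfolding Im_cinner lin A' A ..
  qed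
  then have "adjoint_op T = Blinfun A" by (intro adjoint_op_unique) blast
  with * show ?thesis by simp
qed


section \<open>C*-algebras of operators, completely positive maps, boundary representations\<close>

text \<open>C*-algebras are represented concretely, as norm-closed unital *-subalgebras of \<open>B(H)\<close>.\<close>

definition unital_cstar_algebra ::
    "('a::complex_hilbert_space \<Rightarrow>\<^sub>L 'a) set \<Rightarrow> bool" where
  "unital_cstar_algebra A \<longleftrightarrow>
     A \<subseteq> bounded_ops \<and> csubspace A \<and> id_blinfun \<in> A \<and>
     (\<forall>S\<in>A. \<forall>T\<in>A. S o\<^sub>L T \<in> A) \<and> (\<forall>T\<in>A. adjoint_op T \<in> A) \<and> closed A"

definition cstar_generated ::
    "('a::complex_hilbert_space \<Rightarrow>\<^sub>L 'a) set \<Rightarrow> ('a \<Rightarrow>\<^sub>L 'a) set" where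
  "cstar_generated S = unital_cstar_algebra hull S"

definition positive_op_matrix ::
    "nat \<Rightarrow> (nat \<Rightarrow> nat \<Rightarrow> 'a::complex_hilbert_space \<Rightarrow>\<^sub>L 'a) \<Rightarrow> bool" where
  "positive_op_matrix m A \<longleftrightarrow>
     (\<forall>x :: nat \<Rightarrow> 'a.
        (\<Sum>i<m. \<Sum>j<m. cinner (blinfun_apply (A i j) (x j)) (x i)) \<in> \<real>\<^sub>\<ge>\<^sub>0)"

definition completely_positive_on ::
    "('a::complex_hilbert_space \<Rightarrow>\<^sub>L 'a) set \<Rightarrow>
     (('a \<Rightarrow>\<^sub>L 'a) \<Rightarrow> ('b::complex_hilbert_space \<Rightarrow>\<^sub>L 'b)) \<Rightarrow> bool" where
  "completely_positive_on B \<Phi> \<longleftrightarrow>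
     \<Phi> ` B \<subseteq> bounded_ops \<and> clinear_on B \<Phi> \<and>
     (\<forall>m A. (\<forall>i<m. \<forall>j<m. A i j \<in> B) \<and> positive_op_matrix m A \<longrightarrow>
        positive_op_matrix m (\<lambda>i j. \<Phi> (A i j)))"

definition irreducible_representation ::
    "('a::complex_hilbert_space \<Rightarrow>\<^sub>L 'a) set \<Rightarrow>
     (('a \<Rightarrow>\<^sub>L 'a) \<Rightarrow> ('b::complex_hilbert_space \<Rightarrow>\<^sub>L 'b)) \<Rightarrow> bool" where
  "irreducible_representation B \<pi> \<longleftrightarrow>
     \<pi> ` B \<subseteq> bounded_ops \<and> clinear_on B \<pi> \<and> \<pi> id_blinfun = id_blinfun \<and>
     (\<forall>S\<in>B. \<forall>T\<in>B. \<pi> (S o\<^sub>L T) = \<pi> S o\<^sub>L \<pi> T) \<and>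
     (\<forall>T\<in>B. \<pi> (adjoint_op T) = adjoint_op (\<pi> T)) \<and>
     (UNIV :: 'b set) \<noteq> {0} \<and>
     (\<forall>M. csubspace M \<and> closed M \<and> (\<forall>T\<in>B. blinfun_apply (\<pi> T) ` M \<subseteq> M) \<longrightarrow>
        M = {0} \<or> M = UNIV)"

definition boundary_representation ::
    "('a::complex_hilbert_space \<Rightarrow>\<^sub>L 'a) set \<Rightarrow> ('a \<Rightarrow>\<^sub>L 'a) set \<Rightarrow>
     (('a \<Rightarrow>\<^sub>L 'a) \<Rightarrow> ('b::complex_hilbert_space \<Rightarrow>\<^sub>L 'b)) \<Rightarrow> bool" where
  "boundary_representation B S \<pi> \<longleftrightarrow>
     unital_cstar_algebra B \<and> csubspace S \<and> id_blinfun \<in> S \<and> B = cstar_generated S \<and>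
     irreducible_representation B \<pi> \<and>
     completely_positive_on B \<pi> \<and>
     (\<forall>\<Phi>. completely_positive_on B \<Phi> \<and> (\<forall>s\<in>S. \<Phi> s = \<pi> s) \<longrightarrow> (\<forall>T\<in>B. \<Phi> T = \<pi> T))"

definition boundary_property ::
    "('n \<Rightarrow> 'a::complex_hilbert_space \<Rightarrow>\<^sub>L 'a) \<Rightarrow> bool" where
  "boundary_property W \<longleftrightarrow>
     boundary_representation (cstar_generated (range W)) (cspan (insert id_blinfun (range W)))
       (\<lambda>T. T)"


section \<open>Invariant subspaces and rigidity\<close>

definition closed_invariant_subspace ::
    "('n \<Rightarrow> 'a::complex_hilbert_space \<Rightarrow>\<^sub>L 'a) \<Rightarrow> 'a set \<Rightarrow> bool" where
  "closed_invariant_subspace W M \<longleftrightarrow>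
     csubspace M \<and> closed M \<and> (\<forall>i. blinfun_apply (W i) ` M \<subseteq> M)"

definition unitary_between ::
    "'a::complex_hilbert_space set \<Rightarrow> 'b::complex_hilbert_space set \<Rightarrow> ('a \<Rightarrow> 'b) \<Rightarrow> bool" where
  "unitary_between M N U \<longleftrightarrow>
     clinear_on M U \<and> U ` M = N \<and> (\<forall>x\<in>M. \<forall>y\<in>M. cinner (U x) (U y) = cinner x y)"

definition unitarily_equivalent ::
    "('n \<Rightarrow> 'a::complex_hilbert_space \<Rightarrow>\<^sub>L 'a) \<Rightarrow> 'a set \<Rightarrow> 'a set \<Rightarrow> bool" where
  "unitarily_equivalent W M N \<longleftrightarrow>
     (\<exists>U. unitary_between M N U \<and>
        (\<forall>i. \<forall>x\<in>M. U (blinfun_apply (W i) x) = blinfun_apply (W i) (U x)))"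

definition rigid ::
    "'a set \<Rightarrow> ('n \<Rightarrow> 'a::complex_hilbert_space \<Rightarrow>\<^sub>L 'a) \<Rightarrow> bool" where
  "rigid M W \<longleftrightarrow>
     closed_invariant_subspace W M \<and>
     (\<forall>N. closed_invariant_subspace W N \<and> unitarily_equivalent W M N \<longrightarrow> N = M)"


section \<open>The Hilbert space of square-summable families\<close>

definition square_summable :: "('i \<Rightarrow> complex) \<Rightarrow> bool" where
  "square_summable f \<longleftrightarrow> (\<lambda>a. (cmod (f a))\<^sup>2) summable_on UNIV"

lemma square_summable_zero: "square_summable (\<lambda>_. 0)"
  by (simp add: square_summable_def)

lemma square_summable_mult:
  assumes d: "\<And>a. cmod (d a) \<le> K" and f: "square_summable f"
  shows "square_summable (\<lambda>a. d a * f a)"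
  unfolding square_summable_def
proof (rule summable_on_comparison_test)
  show "(\<lambda>a. K\<^sup>2 * (cmod (f a))\<^sup>2) summable_on UNIV"
    using f unfolding square_summable_def by (rule summable_on_cmult_right)
  show "(cmod (d a * f a))\<^sup>2 \<le> K\<^sup>2 * (cmod (f a))\<^sup>2" for a
    using power_mono[OF d[of a] norm_ge_zero, of 2]
    by (simp add: norm_mult power_mult_distrib mult_right_mono)
qed auto

lemma square_summable_add:
  assumes f: "square_summable f" and g: "square_summable g"
  shows "square_summable (\<lambda>a. f a + g a)"
  unfolding square_summable_def
proof (rule summable_on_comparison_test)
  show "(\<lambda>a. 2 * (cmod (f a))\<^sup>2 + 2 * (cmod (g a))\<^sup>2) summable_on UNIV"
    using f g unfolding square_summable_def
    by (intro summable_on_add summable_on_cmult_right)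
  show "(cmod (f a + g a))\<^sup>2 \<le> 2 * (cmod (f a))\<^sup>2 + 2 * (cmod (g a))\<^sup>2" for a
  proof -
    have "(cmod (f a + g a))\<^sup>2 \<le> (cmod (f a) + cmod (g a))\<^sup>2"
      by (intro power_mono norm_triangle_ineq) simp
    also have "\<dots> \<le> 2 * (cmod (f a))\<^sup>2 + 2 * (cmod (g a))\<^sup>2"
      using sum_squares_bound[of "cmod (f a)" "cmod (g a)"] by (simp add: power2_sum)
    finally show ?thesis .
  qed
qed auto

lemma square_summable_inner:
  assumes f: "square_summable f" and g: "square_summable g"
  shows "(\<lambda>a. f a * cnj (g a)) summable_on UNIV"
proof (rule abs_summable_summable, rule summable_on_comparison_test)
  show "(\<lambda>a. (cmod (f a))\<^sup>2 + (cmod (g a))\<^sup>2) summable_on UNIV"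
    using f g unfolding square_summable_def by (rule summable_on_add)
  show "norm (f a * cnj (g a)) \<le> (cmod (f a))\<^sup>2 + (cmod (g a))\<^sup>2" for a
  proof -
    have "x * y \<le> x\<^sup>2 + y\<^sup>2" if "x \<ge> 0" "y \<ge> 0" for x y :: real
    proof -
      have "0 \<le> x * y" using that by simp
      with sum_squares_bound[of x y] show ?thesis by simp
    qed
    then show ?thesis by (simp add: norm_mult)
  qed
qed auto

typedef 'i ell2 = "{f :: 'i \<Rightarrow> complex. square_summable f}"
  morphisms ell2_coeff Abs_ell2
  using square_summable_zero by blast

setup_lifting type_definition_ell2

lemma square_summable_coeff [simp]: "square_summable (ell2_coeff x)"
  using ell2_coeff[of x] by simp

lemma ell2_eqI: "(\<And>a. ell2_coeff x a = ell2_coeff y a) \<Longrightarrow> x = y"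
  by (simp add: ell2_coeff_inject[symmetric] fun_eq_iff)

instantiation ell2 :: (type) complex_vector
begin

lift_definition zero_ell2 :: "'a ell2" is "\<lambda>_. 0" by (rule square_summable_zero)

lift_definition plus_ell2 :: "'a ell2 \<Rightarrow> 'a ell2 \<Rightarrow> 'a ell2" is "\<lambda>f g a. f a + g a"
  by (rule square_summable_add)

lift_definition uminus_ell2 :: "'a ell2 \<Rightarrow> 'a ell2" is "\<lambda>f a. - f a"
  by (simp add: square_summable_def)

lift_definition minus_ell2 :: "'a ell2 \<Rightarrow> 'a ell2 \<Rightarrow> 'a ell2" is "\<lambda>f g a. f a - g a"
proof -
  fix f g :: "'a \<Rightarrow> complex" assume "square_summable f" "square_summable g"
  then show "square_summable (\<lambda>a. f a - g a)"
    using square_summable_add[of f "\<lambda>a. - g a"] by (simp add: square_summable_def)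
qed

lift_definition scaleC_ell2 :: "complex \<Rightarrow> 'a ell2 \<Rightarrow> 'a ell2" is "\<lambda>c f a. c * f a"
  by (rule square_summable_mult[OF order_refl])

definition scaleR_ell2 :: "real \<Rightarrow> 'a ell2 \<Rightarrow> 'a ell2" where
  "scaleR_ell2 r x = complex_of_real r *\<^sub>C x"

instance
  by standard
    (rule ell2_eqI, simp add: scaleR_ell2_def zero_ell2.rep_eq plus_ell2.rep_eq uminus_ell2.rep_eq
      minus_ell2.rep_eq scaleC_ell2.rep_eq algebra_simps)+

end

instantiation ell2 :: (type) real_inner
begin

definition inner_ell2 :: "'a ell2 \<Rightarrow> 'a ell2 \<Rightarrow> real" where
  "inner_ell2 x y = Re (\<Sum>\<^sub>\<infinity>a. ell2_coeff x a * cnj (ell2_coeff y a))"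

definition norm_ell2 :: "'a ell2 \<Rightarrow> real" where
  "norm_ell2 x = sqrt (inner x x)"

definition dist_ell2 :: "'a ell2 \<Rightarrow> 'a ell2 \<Rightarrow> real" where
  "dist_ell2 x y = norm (x - y)"

definition sgn_ell2 :: "'a ell2 \<Rightarrow> 'a ell2" where
  "sgn_ell2 x = x /\<^sub>R norm x"

definition uniformity_ell2 :: "('a ell2 \<times> 'a ell2) filter" where
  "uniformity_ell2 = (INF e\<in>{0<..}. principal {(x, y). dist x y < e})"

definition open_ell2 :: "'a ell2 set \<Rightarrow> bool" where
  "open_ell2 U = (\<forall>x\<in>U. eventually (\<lambda>(x', y). x' = x \<longrightarrow> y \<in> U) uniformity)"

lemma ell2_inner_summable: "(\<lambda>a. ell2_coeff x a * cnj (ell2_coeff y a)) summable_on UNIV"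
  by (simp add: square_summable_inner)

lemma ell2_inner_self: "inner x x = (\<Sum>\<^sub>\<infinity>a. (cmod (ell2_coeff x a))\<^sup>2)" for x :: "'a ell2"
proof -
  have "inner x x = (\<Sum>\<^sub>\<infinity>a. Re (ell2_coeff x a * cnj (ell2_coeff x a)))"
    unfolding inner_ell2_def by (simp only: infsum_Re[OF ell2_inner_summable])
  also have "\<dots> = (\<Sum>\<^sub>\<infinity>a. (cmod (ell2_coeff x a))\<^sup>2)"
    by (intro infsum_cong) (simp add: cmod_power2, simp add: power2_eq_square)
  finally show ?thesis .
qed

instance
proof
  fix x y z :: "'a ell2" and r :: real
  have "(\<Sum>\<^sub>\<infinity>a. ell2_coeff x a * cnj (ell2_coeff y a)) =
      cnj (\<Sum>\<^sub>\<infinity>a. ell2_coeff y a * cnj (ell2_coeff x a))"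
    by (subst infsum_cnj[symmetric]) (simp add: mult.commute)
  then show "inner x y = inner y x" by (simp add: inner_ell2_def)
  show "inner (x + y) z = inner x z + inner y z"
    unfolding inner_ell2_def
    by (subst plus_complex.sel(1)[symmetric],
        subst infsum_add[OF ell2_inner_summable ell2_inner_summable, symmetric])
      (simp add: plus_ell2.rep_eq distrib_right)
  have "(\<Sum>\<^sub>\<infinity>a. ell2_coeff (r *\<^sub>R x) a * cnj (ell2_coeff y a)) =
      complex_of_real r * (\<Sum>\<^sub>\<infinity>a. ell2_coeff x a * cnj (ell2_coeff y a))"
    by (subst infsum_cmult_right'[symmetric])
      (simp add: scaleR_ell2_def scaleC_ell2.rep_eq mult.assoc)
  then show "inner (r *\<^sub>R x) y = r * inner x y" by (simp add: inner_ell2_def)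
  show "0 \<le> inner x x"
    unfolding ell2_inner_self by (rule infsum_nonneg) simp
  show "inner x x = 0 \<longleftrightarrow> x = 0"
  proof
    assume 0: "inner x x = 0"
    have "(cmod (ell2_coeff x a))\<^sup>2 = 0" for a
    proof (rule nonneg_infsum_le_0D[where A = UNIV and f = "\<lambda>a. (cmod (ell2_coeff x a))\<^sup>2"])
      show "(\<lambda>a. (cmod (ell2_coeff x a))\<^sup>2) summable_on UNIV"
        using square_summable_coeff[of x] unfolding square_summable_def .
    qed (use 0 in \<open>simp_all add: ell2_inner_self\<close>)
    then show "x = 0" by (intro ell2_eqI) (simp add: zero_ell2.rep_eq)
  qed (simp add: ell2_inner_self zero_ell2.rep_eq)
  show "norm x = sqrt (inner x x)" by (rule norm_ell2_def)
  show "dist x y = norm (x - y)" by (rule dist_ell2_def)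
  show "sgn x = x /\<^sub>R norm x" by (rule sgn_ell2_def)
  show "uniformity =
      (INF e\<in>{0<..}. principal {(x, y). dist x y < (e::real)} :: ('a ell2 \<times> 'a ell2) filter)"
    by (rule uniformity_ell2_def)
  show "open U = (\<forall>x\<in>U. \<forall>\<^sub>F (x', y) in uniformity. x' = x \<longrightarrow> y \<in> U)" for U :: "'a ell2 set"
    by (rule open_ell2_def)
qed

end

lemma ell2_norm_square: "(norm x)\<^sup>2 = (\<Sum>\<^sub>\<infinity>a. (cmod (ell2_coeff x a))\<^sup>2)"
  by (simp add: power2_norm_eq_inner ell2_inner_self)

lemma ell2_sum_le_norm:
  assumes "finite F"
  shows "(\<Sum>a\<in>F. (cmod (ell2_coeff x a))\<^sup>2) \<le> (norm x)\<^sup>2"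
  using square_summable_coeff[of x] assms unfolding square_summable_def ell2_norm_square
  by (intro finite_sum_le_infsum) auto

lemma ell2_coeff_le_norm: "cmod (ell2_coeff x a) \<le> norm x"
  using ell2_sum_le_norm[of "{a}" x] by (auto dest: power2_le_imp_le)

instance ell2 :: (type) complex_normed_vector
proof
  fix c :: complex and x :: "'a ell2"
  have "(norm (c *\<^sub>C x))\<^sup>2 = (cmod c * norm x)\<^sup>2"
    by (simp add: ell2_norm_square power_mult_distrib scaleC_ell2.rep_eq norm_mult
        infsum_cmult_right')
  then show "norm (c *\<^sub>C x) = cmod c * norm x" by (simp add: power2_eq_iff_nonneg)
qed

instance ell2 :: (type) banach
proof
  fix X :: "nat \<Rightarrow> 'a ell2" assume X: "Cauchy X"
  have X': "\<exists>N. \<forall>m\<ge>N. \<forall>n\<ge>N. norm (X m - X n) < e" if "e > 0" for e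
    using X that unfolding Cauchy_def dist_norm by blast
  have "Cauchy (\<lambda>n. ell2_coeff (X n) a)" for a
  proof (rule metric_CauchyI)
    fix e :: real assume "e > 0"
    then obtain N where N: "\<And>m n. m \<ge> N \<Longrightarrow> n \<ge> N \<Longrightarrow> norm (X m - X n) < e" using X' by blast
    have "dist (ell2_coeff (X m) a) (ell2_coeff (X n) a) < e" if "m \<ge> N" "n \<ge> N" for m n
      using N[OF that] ell2_coeff_le_norm[of "X m - X n" a]
      by (simp add: dist_norm minus_ell2.rep_eq)
    then show "\<exists>N. \<forall>m\<ge>N. \<forall>n\<ge>N. dist (ell2_coeff (X m) a) (ell2_coeff (X n) a) < e" by blast
  qed
  then have "\<forall>a. \<exists>l. (\<lambda>n. ell2_coeff (X n) a) \<longlonglongrightarrow> l"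
    using Cauchy_convergent convergent_def by blast
  then obtain l where l: "\<And>a. (\<lambda>n. ell2_coeff (X n) a) \<longlonglongrightarrow> l a" by metis
  have lim_bnd: "(\<Sum>a\<in>F. (cmod (l a - ell2_coeff (X n) a))\<^sup>2) \<le> e\<^sup>2"
    if F: "finite F" and N: "\<And>m. m \<ge> N \<Longrightarrow> norm (X m - X n) < e" for F N n e
  proof (rule LIMSEQ_le_const2)
    show "(\<lambda>m. \<Sum>a\<in>F. (cmod (ell2_coeff (X m) a - ell2_coeff (X n) a))\<^sup>2)
        \<longlonglongrightarrow> (\<Sum>a\<in>F. (cmod (l a - ell2_coeff (X n) a))\<^sup>2)"
      by (intro tendsto_intros l)
    have "(\<Sum>a\<in>F. (cmod (ell2_coeff (X m) a - ell2_coeff (X n) a))\<^sup>2) \<le> e\<^sup>2" if "m \<ge> N" for m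
    proof -
      have "(\<Sum>a\<in>F. (cmod (ell2_coeff (X m) a - ell2_coeff (X n) a))\<^sup>2) \<le> (norm (X m - X n))\<^sup>2"
        using ell2_sum_le_norm[OF F, of "X m - X n"] by (simp add: minus_ell2.rep_eq)
      also have "\<dots> \<le> e\<^sup>2" using N[OF that] by (intro power_mono) auto
      finally show ?thesis .
    qed
    then show "\<exists>N. \<forall>m\<ge>N. (\<Sum>a\<in>F. (cmod (ell2_coeff (X m) a - ell2_coeff (X n) a))\<^sup>2) \<le> e\<^sup>2"
      by blast
  qed
  have sqs: "square_summable (\<lambda>a. l a - ell2_coeff (X n) a)"
    if N: "\<And>m. m \<ge> N \<Longrightarrow> norm (X m - X n) < e" for n N e
    unfolding square_summable_def
  proof (rule nonneg_bdd_above_summable_on)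
    show "bdd_above (sum (\<lambda>a. (cmod (l a - ell2_coeff (X n) a))\<^sup>2) ` {F. F \<subseteq> UNIV \<and> finite F})"
      by (rule bdd_aboveI2[where M = "e\<^sup>2"]) (use lim_bnd[OF _ N] in auto)
  qed simp
  obtain N where "\<And>m n. m \<ge> N \<Longrightarrow> n \<ge> N \<Longrightarrow> norm (X m - X n) < 1"
    using X'[OF zero_less_one] by blast
  then have "square_summable (\<lambda>a. l a - ell2_coeff (X N) a)" by (rule sqs) auto
  from square_summable_add[OF this square_summable_coeff[of "X N"]]
  have "square_summable l" by simp
  then obtain L where L: "ell2_coeff L = l" using Abs_ell2_inverse by blast
  have "X \<longlonglongrightarrow> L"
  proof (rule LIMSEQ_I)
    fix e :: real assume e: "e > 0"
    then obtain N where N: "\<And>m n. m \<ge> N \<Longrightarrow> n \<ge> N \<Longrightarrow> norm (X m - X n) < e / 2"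
      using X'[of "e / 2"] by auto
    have "norm (X n - L) < e" if n: "n \<ge> N" for n
    proof -
      have Nn: "norm (X m - X n) < e / 2" if "m \<ge> N" for m using N n that by blast
      have "(norm (L - X n))\<^sup>2 = (\<Sum>\<^sub>\<infinity>a. (cmod (l a - ell2_coeff (X n) a))\<^sup>2)"
        by (simp add: ell2_norm_square minus_ell2.rep_eq L)
      also have "\<dots> \<le> (e / 2)\<^sup>2"
        using sqs[OF Nn] lim_bnd[OF _ Nn] unfolding square_summable_def
        by (intro infsum_le_finite_sums) auto
      finally have "norm (L - X n) \<le> e / 2" using e by (auto dest: power2_le_imp_le)
      then show ?thesis using e by (simp add: norm_minus_commute)
    qed
    then show "\<exists>N. \<forall>n\<ge>N. norm (X n - L) < e" by blast
  qed
  then show "convergent X" by (rule convergentI)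
qed

instantiation ell2 :: (type) complex_hilbert_space
begin

definition cinner_ell2 :: "'a ell2 \<Rightarrow> 'a ell2 \<Rightarrow> complex" where
  "cinner_ell2 x y = (\<Sum>\<^sub>\<infinity>a. ell2_coeff x a * cnj (ell2_coeff y a))"

instance
proof
  fix x y z :: "'a ell2" and c :: complex
  show "cinner x y = cnj (cinner y x)"
    unfolding cinner_ell2_def by (subst infsum_cnj[symmetric]) (simp add: mult.commute)
  show "cinner (x + y) z = cinner x z + cinner y z"
    unfolding cinner_ell2_def
    by (subst infsum_add[OF ell2_inner_summable ell2_inner_summable, symmetric])
      (simp add: plus_ell2.rep_eq distrib_right)
  show "cinner (c *\<^sub>C x) y = c * cinner x y"
    unfolding cinner_ell2_def
    by (subst infsum_cmult_right'[symmetric]) (simp add: scaleC_ell2.rep_eq mult.assoc)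
  show "inner x y = Re (cinner x y)" by (simp add: inner_ell2_def cinner_ell2_def)
qed

end


section \<open>The full Fock space and the universal model\<close>

text \<open>A word \<open>g\<^bsub>i1\<^esub> \<dots> g\<^bsub>ik\<^esub>\<close> of the free semigroup on \<open>n\<close> generators is the list
  \<open>[i1, \<dots>, ik]\<close> over a finite type \<open>'n\<close> with \<open>n\<close> elements. The vectors \<open>e\<^sub>\<alpha>\<close> form an orthonormal
  basis of the full Fock space, which is therefore the space of square-summable families
  (coefficients with respect to this basis) indexed by words.\<close>

type_synonym 'n fock = "'n list ell2"

lift_definition fock_basis :: "'n list \<Rightarrow> 'n fock" is "\<lambda>\<alpha> \<beta>. if \<beta> = \<alpha> then 1 else 0"
proof -
  fix \<alpha> :: "'n list"
  show "square_summable (\<lambda>\<beta>. if \<beta> = \<alpha> then 1 else 0)"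
    unfolding square_summable_def
    by (rule summable_on_cong_neutral[where T = "{\<alpha>}", THEN iffD2]) auto
qed

text \<open>\<open>left_creation i \<phi> = e\<^sub>i \<otimes> \<phi>\<close>: the coefficient of \<open>\<phi>\<close> at \<open>\<alpha>\<close> moves to \<open>g\<^sub>i \<alpha>\<close>.\<close>

definition left_creation :: "'n \<Rightarrow> 'n fock \<Rightarrow>\<^sub>L 'n fock" where
  "left_creation i = Blinfun (\<lambda>\<phi>. Abs_ell2 (\<lambda>\<beta>.
     case \<beta> of [] \<Rightarrow> 0 | j # \<alpha> \<Rightarrow> if j = i then ell2_coeff \<phi> \<alpha> else 0))"

text \<open>The diagonal operator \<open>e\<^sub>a \<mapsto> d a *\<^sub>C e\<^sub>a\<close>; meaningful for bounded \<open>d\<close> only.\<close>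

definition diagonal_op :: "('i \<Rightarrow> complex) \<Rightarrow> 'i ell2 \<Rightarrow>\<^sub>L 'i ell2" where
  "diagonal_op d = Blinfun (\<lambda>\<phi>. Abs_ell2 (\<lambda>a. d a * ell2_coeff \<phi> a))"

text \<open>A formal power series in noncommuting indeterminates is given by its family of coefficients
  \<open>b\<close>. The exponent \<open>1 / (2 * k)\<close> at \<open>k = 0\<close> is irrelevant for the limit superior.\<close>

definition free_holomorphic_near_0 :: "('n::finite list \<Rightarrow> real) \<Rightarrow> bool" where
  "free_holomorphic_near_0 b \<longleftrightarrow>
     limsup (\<lambda>k. ereal ((\<Sum>\<alpha> | length \<alpha> = k. (b \<alpha>)\<^sup>2) powr (1 / (2 * real k)))) < \<infinity>"

definition universal_model :: "('n list \<Rightarrow> real) \<Rightarrow> 'n \<Rightarrow> 'n fock \<Rightarrow>\<^sub>L 'n fock" where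
  "universal_model b i =
     left_creation i o\<^sub>L diagonal_op (\<lambda>\<alpha>. complex_of_real (sqrt (b \<alpha> / b (i # \<alpha>))))"

lemma norm_ell2_le:
  fixes x y :: "'i ell2"
  assumes "(\<Sum>\<^sub>\<infinity>a. (cmod (ell2_coeff y a))\<^sup>2) \<le> K\<^sup>2 * (\<Sum>\<^sub>\<infinity>a. (cmod (ell2_coeff x a))\<^sup>2)" and "K \<ge> 0"
  shows "norm y \<le> norm x * K"
proof -
  have "(norm y)\<^sup>2 \<le> (norm x * K)\<^sup>2"
    using assms(1) by (simp add: ell2_norm_square power_mult_distrib mult.commute)
  then show ?thesis using assms(2) by (auto dest: power2_le_imp_le)
qed

lemma left_creation_coeff:
  "ell2_coeff (blinfun_apply (left_creation i) \<phi>) \<beta> =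
     (case \<beta> of [] \<Rightarrow> 0 | j # \<alpha> \<Rightarrow> if j = i then ell2_coeff \<phi> \<alpha> else 0)"
proof -
  define f where "f = (\<lambda>\<phi> \<beta>. case \<beta> of [] \<Rightarrow> 0 | j # \<alpha> \<Rightarrow> if j = i then ell2_coeff \<phi> \<alpha> else 0)"
  have f_Cons: "f \<phi> (i # \<alpha>) = ell2_coeff \<phi> \<alpha>" for \<phi> \<alpha> by (simp add: f_def)
  have f_0: "f \<phi> \<beta> = 0" if "\<beta> \<notin> range ((#) i)" for \<phi> \<beta>
    using that by (auto simp: f_def split: list.split)
  have hs: "((\<lambda>\<beta>. (cmod (f \<phi> \<beta>))\<^sup>2) has_sum (\<Sum>\<^sub>\<infinity>\<alpha>. (cmod (ell2_coeff \<phi> \<alpha>))\<^sup>2)) UNIV" for \<phi>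
  proof -
    have "((\<lambda>\<alpha>. (cmod (ell2_coeff \<phi> \<alpha>))\<^sup>2) has_sum (\<Sum>\<^sub>\<infinity>\<alpha>. (cmod (ell2_coeff \<phi> \<alpha>))\<^sup>2)) UNIV"
      using square_summable_coeff[of \<phi>] unfolding square_summable_def by (rule has_sum_infsum)
    then have "((\<lambda>\<beta>. (cmod (f \<phi> \<beta>))\<^sup>2) has_sum (\<Sum>\<^sub>\<infinity>\<alpha>. (cmod (ell2_coeff \<phi> \<alpha>))\<^sup>2)) (range ((#) i))"
      by (subst has_sum_reindex) (simp_all add: o_def f_Cons)
    then show ?thesis
      by (rule has_sum_cong_neutral[THEN iffD1, rotated -1]) (auto simp: f_0)
  qed
  then have "square_summable (f \<phi>)" for \<phi>
    unfolding square_summable_def using summable_on_def by blast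
  then have co: "ell2_coeff (Abs_ell2 (f \<phi>)) = f \<phi>" for \<phi>
    by (simp add: Abs_ell2_inverse)
  have "bounded_linear (\<lambda>\<phi>. Abs_ell2 (f \<phi>))"
  proof (rule bounded_linear_intro[where K = 1])
    show "Abs_ell2 (f (x + y)) = Abs_ell2 (f x) + Abs_ell2 (f y)" for x y
      by (rule ell2_eqI) (simp add: co plus_ell2.rep_eq, simp add: f_def plus_ell2.rep_eq split: list.split)
    show "Abs_ell2 (f (r *\<^sub>R x)) = r *\<^sub>R Abs_ell2 (f x)" for r x
      by (rule ell2_eqI)
        (simp add: co scaleR_ell2_def scaleC_ell2.rep_eq,
         simp add: f_def scaleR_ell2_def scaleC_ell2.rep_eq split: list.split)
    show "norm (Abs_ell2 (f x)) \<le> norm x * 1" for x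
      by (rule norm_ell2_le) (simp_all add: co infsumI[OF hs])
  qed
  moreover have "left_creation i = Blinfun (\<lambda>\<phi>. Abs_ell2 (f \<phi>))"
    by (simp only: left_creation_def f_def)
  ultimately have "ell2_coeff (blinfun_apply (left_creation i) \<phi>) \<beta> = f \<phi> \<beta>"
    by (simp add: bounded_linear_Blinfun_apply co)
  then show ?thesis by (simp add: f_def)
qed

lemma diagonal_op_coeff:
  assumes d: "\<And>a. cmod (d a) \<le> K"
  shows "ell2_coeff (blinfun_apply (diagonal_op d) \<phi>) a = d a * ell2_coeff \<phi> a"
proof -
  define f where "f = (\<lambda>\<phi> a. d a * ell2_coeff \<phi> a)"
  have "square_summable (f \<phi>)" for \<phi>
    unfolding f_def using d by (rule square_summable_mult) simp
  then have co: "ell2_coeff (Abs_ell2 (f \<phi>)) = f \<phi>" for \<phi>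
    by (simp add: Abs_ell2_inverse)
  have K: "K \<ge> 0" using d[of undefined] norm_ge_zero order_trans by blast
  have "bounded_linear (\<lambda>\<phi>. Abs_ell2 (f \<phi>))"
  proof (rule bounded_linear_intro[where K = K])
    show "Abs_ell2 (f (x + y)) = Abs_ell2 (f x) + Abs_ell2 (f y)" for x y
      by (rule ell2_eqI)
        (simp only: co plus_ell2.rep_eq, simp only: f_def plus_ell2.rep_eq distrib_left)
    show "Abs_ell2 (f (r *\<^sub>R x)) = r *\<^sub>R Abs_ell2 (f x)" for r x
      by (rule ell2_eqI)
        (simp only: co scaleR_ell2_def scaleC_ell2.rep_eq,
         simp only: f_def scaleC_ell2.rep_eq mult.left_commute)
    show "norm (Abs_ell2 (f x)) \<le> norm x * K" for x
    proof (rule norm_ell2_le[OF _ K])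
      have "(\<Sum>\<^sub>\<infinity>a. (cmod (f x a))\<^sup>2) \<le> (\<Sum>\<^sub>\<infinity>a. K\<^sup>2 * (cmod (ell2_coeff x a))\<^sup>2)"
      proof (rule infsum_mono)
        show "(\<lambda>a. (cmod (f x a))\<^sup>2) summable_on UNIV"
          using \<open>square_summable (f x)\<close> unfolding square_summable_def .
        show "(\<lambda>a. K\<^sup>2 * (cmod (ell2_coeff x a))\<^sup>2) summable_on UNIV"
          using square_summable_coeff[of x] unfolding square_summable_def
          by (rule summable_on_cmult_right)
        show "(cmod (f x a))\<^sup>2 \<le> K\<^sup>2 * (cmod (ell2_coeff x a))\<^sup>2" for a
          using power_mono[OF d[of a] norm_ge_zero, of 2]
          by (simp add: f_def norm_mult power_mult_distrib mult_right_mono)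
      qed
      then show "(\<Sum>\<^sub>\<infinity>a. (cmod (ell2_coeff (Abs_ell2 (f x)) a))\<^sup>2)
          \<le> K\<^sup>2 * (\<Sum>\<^sub>\<infinity>a. (cmod (ell2_coeff x a))\<^sup>2)"
        by (simp add: co infsum_cmult_right')
    qed
  qed
  moreover have "diagonal_op d = Blinfun (\<lambda>\<phi>. Abs_ell2 (f \<phi>))"
    by (simp only: diagonal_op_def f_def)
  ultimately have "ell2_coeff (blinfun_apply (diagonal_op d) \<phi>) a = f \<phi> a"
    by (simp add: bounded_linear_Blinfun_apply co)
  then show ?thesis by (simp add: f_def)
qed

lemma universal_model_coeff:
  assumes pos: "\<And>\<alpha>. b \<alpha> > 0" and bdd: "bdd_above (range (\<lambda>\<alpha>. b \<alpha> / b (i # \<alpha>)))"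
  shows "ell2_coeff (blinfun_apply (universal_model b i) \<phi>) \<beta> =
    (case \<beta> of [] \<Rightarrow> 0
     | j # \<alpha> \<Rightarrow> if j = i then complex_of_real (sqrt (b \<alpha> / b (i # \<alpha>))) * ell2_coeff \<phi> \<alpha> else 0)"
proof -
  obtain K where K: "\<And>\<alpha>. b \<alpha> / b (i # \<alpha>) \<le> K" using bdd by (auto simp: bdd_above_def)
  have "cmod (complex_of_real (sqrt (b \<alpha> / b (i # \<alpha>)))) \<le> sqrt K" for \<alpha>
    using K[of \<alpha>] pos[of \<alpha>] pos[of "i # \<alpha>"] by (simp add: less_imp_le)
  note D = diagonal_op_coeff[of "\<lambda>\<alpha>. complex_of_real (sqrt (b \<alpha> / b (i # \<alpha>)))", OF this]
  show ?thesis
    unfolding universal_model_def blinfun_apply_blinfun_compose left_creation_coeff D ..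
qed

lemma universal_model_basis:
  assumes "\<And>\<alpha>. b \<alpha> > 0" and "bdd_above (range (\<lambda>\<alpha>. b \<alpha> / b (i # \<alpha>)))"
  shows "blinfun_apply (universal_model b i) (fock_basis \<alpha>) =
    complex_of_real (sqrt (b \<alpha> / b (i # \<alpha>))) *\<^sub>C fock_basis (i # \<alpha>)"
  by (rule ell2_eqI)
    (auto simp: universal_model_coeff[OF assms] scaleC_ell2.rep_eq fock_basis.rep_eq split: list.split)

end

(* An invariant subspace equivalent to the whole space is the range of an isometry U commuting
   with every W i. The map T \<mapsto> U* T U is completely positive and fixes the identity and the W i,
   so the boundary property makes it the identity on the generated C*-algebra. A map of the form
   T \<mapsto> U* T U that fixes both T and T* T forces T U = U T, so the range of U is invariant under
   the whole algebra, which is irreducible. *)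

theory Submission
  imports Defs
begin

lemma cinner_scaleC_right: "cinner x (c *\<^sub>C y) = cnj c * cinner x y"
  by (metis cinner_commute cinner_scaleC_left complex_cnj_mult)

lemma cinner_ext:
  assumes "\<And>x. cinner x y = cinner x z"
  shows "y = z"
proof -
  have "inner x y = inner x z" for x
    using assms[of x] by (simp add: inner_eq_Re_cinner)
  then show ?thesis using vector_eq_ldot by blast
qed

lemma bounded_opsD:
  assumes "T \<in> bounded_ops"
  shows "blinfun_apply T (c *\<^sub>C x) = c *\<^sub>C blinfun_apply T x"
  using assms by (simp add: bounded_ops_def clinear_on_def)

lemma bounded_opsI:
  assumes "\<And>c x. blinfun_apply T (c *\<^sub>C x) = c *\<^sub>C blinfun_apply T x"
  shows "T \<in> bounded_ops"
  using assms by (simp add: bounded_ops_def clinear_on_def blinfun.add_right)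

lemma bounded_ops_compose:
  assumes "S \<in> bounded_ops" and "T \<in> bounded_ops"
  shows "S o\<^sub>L T \<in> bounded_ops"
  by (rule bounded_opsI) (simp add: assms bounded_opsD)

lemma bounded_ops_adjoint:
  assumes T: "T \<in> bounded_ops"
  shows "adjoint_op T \<in> bounded_ops"
proof (rule bounded_opsI, rule cinner_ext)
  show "cinner x (blinfun_apply (adjoint_op T) (c *\<^sub>C y)) =
      cinner x (c *\<^sub>C blinfun_apply (adjoint_op T) y)" for c x y
    by (simp add: cinner_scaleC_right flip: cinner_adjoint[OF T])
qed

lemma isometry_adjoint_compose:
  assumes V: "V \<in> bounded_ops"
    and iso: "\<And>x y. cinner (blinfun_apply V x) (blinfun_apply V y) = cinner x y"
  shows "adjoint_op V o\<^sub>L V = id_blinfun"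
proof (rule blinfun_eqI, rule cinner_ext)
  show "cinner x (blinfun_apply (adjoint_op V o\<^sub>L V) y) = cinner x (blinfun_apply id_blinfun y)"
    for x y
    by (simp add: iso flip: cinner_adjoint[OF V])
qed

text \<open>Unitary equivalence provides only a bare function, while \<open>adjoint_op\<close> takes
  an element of the operator type. Preserving \<open>cinner\<close> preserves norms, so 1 serves as
  the bound.\<close>

lemma isometry_blinfun:
  fixes U :: "'a::complex_hilbert_space \<Rightarrow> 'b::complex_hilbert_space"
  assumes lin: "clinear_on UNIV U" and iso: "\<And>x y. cinner (U x) (U y) = cinner x y"
  obtains V where "V \<in> bounded_ops" and "blinfun_apply V = U"
proof
  have nrm: "norm (U x) = norm x" for x
    by (simp add: norm_eq_sqrt_inner inner_eq_Re_cinner iso)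
  have "bounded_linear U"
    by (rule bounded_linear_intro[where K = 1])
      (use lin in \<open>simp_all add: clinear_on_def nrm scaleR_eq_scaleC\<close>)
  then show *: "blinfun_apply (Blinfun U) = U" by (rule bounded_linear_Blinfun_apply)
  show "Blinfun U \<in> bounded_ops" using lin by (simp add: bounded_ops_def *)
qed

text \<open>For an isometry \<open>V\<close> this is the compression of \<open>T\<close> to the
  range of \<open>V\<close>, carried back to the domain along \<open>V\<close>.\<close>

definition conj_op :: "('a::complex_hilbert_space \<Rightarrow>\<^sub>L 'b::complex_hilbert_space) \<Rightarrow>
    ('b \<Rightarrow>\<^sub>L 'b) \<Rightarrow> 'a \<Rightarrow>\<^sub>L 'a" where
  "conj_op V T = adjoint_op V o\<^sub>L T o\<^sub>L V"

lemma conj_op_apply [simp]: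
  "blinfun_apply (conj_op V T) x = blinfun_apply (adjoint_op V) (blinfun_apply T (blinfun_apply V x))"
  by (simp add: conj_op_def)

lemma cinner_conj_op:
  assumes V: "V \<in> bounded_ops"
  shows "cinner (blinfun_apply (conj_op V T) x) y =
    cinner (blinfun_apply T (blinfun_apply V x)) (blinfun_apply V y)"
  by (metis V cinner_adjoint cinner_commute conj_op_apply)

lemma conj_op_add: "conj_op V (S + T) = conj_op V S + conj_op V T"
  by (rule blinfun_eqI) (simp add: blinfun.add_left blinfun.add_right)

lemma conj_op_scaleC:
  assumes V: "V \<in> bounded_ops"
  shows "conj_op V (c *\<^sub>C T) = c *\<^sub>C conj_op V T"
  by (rule blinfun_eqI) (simp add: bounded_opsD[OF bounded_ops_adjoint[OF V]])

text \<open>The form of the compressed matrix at vectors \<open>x i\<close> is the form of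
  \<open>A\<close> at the vectors \<open>blinfun_apply V (x i)\<close>, so positivity is inherited
  at every size \<open>m\<close>.\<close>

lemma completely_positive_on_conj_op:
  assumes V: "V \<in> bounded_ops" and B: "B \<subseteq> bounded_ops"
  shows "completely_positive_on B (conj_op V)"
proof -
  have "conj_op V T \<in> bounded_ops" if "T \<in> B" for T
    using that B V unfolding conj_op_def by (blast intro: bounded_ops_compose bounded_ops_adjoint)
  moreover have "clinear_on B (conj_op V)"
    by (simp add: clinear_on_def conj_op_add conj_op_scaleC[OF V])
  moreover have "positive_op_matrix m (\<lambda>i j. conj_op V (A i j))" if "positive_op_matrix m A" for m A
    using that unfolding positive_op_matrix_def cinner_conj_op[OF V]
    by (intro allI) (erule spec)
  ultimately show ?thesis
    unfolding completely_positive_on_def by blast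
qed

(* Multiplicative-domain argument: under the hypotheses, |T V x|^2, <T V x, V T x> and |V T x|^2
   all equal |T x|^2. *)
lemma isometry_commutes_if_conj_op_fixed:
  assumes V: "V \<in> bounded_ops" and T: "T \<in> bounded_ops"
    and iso: "\<And>x y. cinner (blinfun_apply V x) (blinfun_apply V y) = cinner x y"
    and fixT: "conj_op V T = T" and fixTT: "conj_op V (adjoint_op T o\<^sub>L T) = adjoint_op T o\<^sub>L T"
  shows "T o\<^sub>L V = V o\<^sub>L T"
proof (rule blinfun_eqI)
  fix x
  let ?a = "blinfun_apply T (blinfun_apply V x)" and ?b = "blinfun_apply V (blinfun_apply T x)"
  let ?c = "blinfun_apply T x"
  have adj: "cinner (blinfun_apply (adjoint_op T) u) v = cinner u (blinfun_apply T v)" for u v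
    by (metis T cinner_adjoint cinner_commute)
  have "cinner ?a ?a = cinner (blinfun_apply (conj_op V (adjoint_op T o\<^sub>L T)) x) x"
    by (simp add: cinner_conj_op[OF V] adj del: conj_op_apply)
  also have "\<dots> = cinner ?c ?c"
    by (simp add: fixTT adj del: conj_op_apply)
  \<comment> \<open>Passing to real parts makes the two cross terms of
    \<open>inner (?a - ?b) (?a - ?b)\<close> coincide, so three real numbers decide the
    claim.\<close>
  finally have aa: "inner ?a ?a = inner ?c ?c" by (simp add: inner_eq_Re_cinner)
  \<comment> \<open>Moving \<open>V\<close> off the second argument turns \<open>T V x\<close> into
    \<open>conj_op V T x\<close>, which \<open>fixT\<close> identifies with
    \<open>?c\<close>.\<close>
  have "cinner ?a ?b = cinner ?c ?c"
    using cinner_conj_op[OF V, of T x ?c] fixT by simp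
  then have ab: "inner ?a ?b = inner ?c ?c" by (simp add: inner_eq_Re_cinner)
  have bb: "inner ?b ?b = inner ?c ?c" by (simp add: inner_eq_Re_cinner iso)
  have "inner (?a - ?b) (?a - ?b) = 0"
    using aa ab bb by (simp add: inner_diff_left inner_diff_right inner_commute)
  then show "blinfun_apply (T o\<^sub>L V) x = blinfun_apply (V o\<^sub>L T) x" by simp
qed

theorem boundary_property_imp_rigid:
  fixes W :: "'n \<Rightarrow> 'a::complex_hilbert_space \<Rightarrow>\<^sub>L 'a"
  assumes "boundary_property W"
  shows "rigid UNIV W"
proof -
  define B where "B = cstar_generated (range W)"
  define S where "S = cspan (insert id_blinfun (range W))"
  have "boundary_representation B S (\<lambda>T. T)"
    using assms by (simp add: boundary_property_def B_def S_def)
  then have alg: "unital_cstar_algebra B"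
    and irr: "irreducible_representation B (\<lambda>T. T)"
    and uniq: "\<And>\<Phi> T. completely_positive_on B \<Phi> \<Longrightarrow> (\<And>s. s \<in> S \<Longrightarrow> \<Phi> s = s) \<Longrightarrow> T \<in> B \<Longrightarrow> \<Phi> T = T"
    unfolding boundary_representation_def by blast+
  have Bops: "B \<subseteq> bounded_ops"
    using alg by (simp add: unital_cstar_algebra_def)
  have nontriv: "(UNIV :: 'a set) \<noteq> {0}"
    using irr by (simp add: irreducible_representation_def)
  have "N = UNIV" if N: "closed_invariant_subspace W N" and eq: "unitarily_equivalent W UNIV N" for N
  proof -
    from eq obtain U where lin: "clinear_on UNIV U" and ran: "range U = N"
      and iso: "\<And>x y. cinner (U x) (U y) = cinner x y"
      and com: "\<And>i x. U (blinfun_apply (W i) x) = blinfun_apply (W i) (U x)"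
      unfolding unitarily_equivalent_def unitary_between_def by auto
    obtain V where V: "V \<in> bounded_ops" and VU: "blinfun_apply V = U"
      using isometry_blinfun[OF lin iso] by blast
    have isoV: "cinner (blinfun_apply V x) (blinfun_apply V y) = cinner x y" for x y
      by (simp add: VU iso)
    have VV: "blinfun_apply (adjoint_op V) (blinfun_apply V x) = x" for x
      using isometry_adjoint_compose[OF V isoV]
      by (metis blinfun_apply_blinfun_compose id_blinfun.rep_eq id_apply)
    \<comment> \<open>Since \<open>V\<close> intertwines \<open>s\<close> with itself, V* s V = V* V
      s = s.\<close>
    have gen: "conj_op V s = s" if "s \<in> insert id_blinfun (range W)" for s
    proof -
      have "blinfun_apply s (blinfun_apply V x) = blinfun_apply V (blinfun_apply s x)" for x
        using that com by (auto simp: VU)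
      then show ?thesis by (intro blinfun_eqI) (simp add: VV)
    qed
    \<comment> \<open>Linearity carries the fixed points from the generators only to their span;
      adjoints and products come afterwards, from uniqueness of the completely positive
      extension.\<close>
    have "conj_op V s = s" if "s \<in> S" for s
      using that unfolding S_def
    proof (rule complex_vector.span_induct)
      show "csubspace {s. conj_op V s = s}"
        by (rule complex_vector.subspaceI)
          (auto simp: conj_op_add conj_op_scaleC[OF V] intro!: blinfun_eqI)
    qed (rule gen)
    then have fixB: "conj_op V T = T" if "T \<in> B" for T
      using uniq[OF completely_positive_on_conj_op[OF V Bops] _ that] by blast
    have commB: "T o\<^sub>L V = V o\<^sub>L T" if "T \<in> B" for T
    proof (rule isometry_commutes_if_conj_op_fixed[OF V _ isoV])
      show "T \<in> bounded_ops" using that Bops by blast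
      \<comment> \<open>Here being fixed on all of \<open>B\<close> matters: this product need not
        lie in \<open>S\<close>.\<close>
      have "adjoint_op T o\<^sub>L T \<in> B"
        using that alg by (simp add: unital_cstar_algebra_def)
      then show "conj_op V (adjoint_op T o\<^sub>L T) = adjoint_op T o\<^sub>L T" by (rule fixB)
    qed (rule fixB[OF that])
    \<comment> \<open>As \<open>B\<close> is closed under adjoints, this makes \<open>N\<close>
      reducing for every \<open>W i\<close>, which is stronger than the invariance assumed of
      it.\<close>
    have "blinfun_apply T ` N \<subseteq> N" if "T \<in> B" for T
    proof -
      have "blinfun_apply T (U x) = U (blinfun_apply T x)" for x
        using commB[OF that] by (metis VU blinfun_apply_blinfun_compose)
      then show ?thesis using ran by auto
    qed
    moreover have "csubspace N" "closed N"
      using N by (simp_all add: closed_invariant_subspace_def)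
    ultimately have "N = {0} \<or> N = UNIV"
      using irr unfolding irreducible_representation_def by blast
    \<comment> \<open>\<open>adjoint_op V\<close> is a left inverse of \<open>V\<close>, so a zero
      range would collapse the whole space; irreducibility includes that the space is
      nonzero.\<close>
    moreover have "N \<noteq> {0}"
    proof
      assume "N = {0}"
      then have "blinfun_apply V x = 0" for x using ran VU by auto
      then have "x = 0" for x :: 'a using VV[of x] by simp
      then show False using nontriv by auto
    qed
    ultimately show ?thesis by blast
  qed
  then show ?thesis
    by (simp add: rigid_def closed_invariant_subspace_def)
qed

theorem proposition6p9:
  fixes b :: "'n::finite list \<Rightarrow> real"
  assumes "b [] = 1"
    and "\<And>\<alpha>. \<alpha> \<noteq> [] \<Longrightarrow> b \<alpha> > 0"
    and "free_holomorphic_near_0 b"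
    and "\<And>i. bdd_above (range (\<lambda>\<alpha>. b \<alpha> / b (i # \<alpha>)))"
    and "boundary_property (universal_model b)"
  shows "rigid UNIV (universal_model b)"
  using assms(5) by (rule boundary_property_imp_rigid)

end
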